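(* For every two positive integers $L_1$ and $L_2$ with $1 < L_1 < L_2$, there exists a disconnected graph $G$ such that $\chi^{\mathrm{FAT}}(G) = L_1$ and $\chi(G) = L_2$.
   Context: All graphs are simple with a finite nonempty vertex set. $\chi(G)$ denotes the chromatic number of $G$. For a vertex $v$ and a set $S\subseteq V(G)$, let $e(v,S)=|S\cap N(v)|$, where $N(v)$ is the set of neighbors of $v$ and $\deg(v)=|N(v)|$. A (not necessarily proper) vertex coloring of $G$ with color classes $V_1,\dots,V_k$ is a Fair And Tolerant (FAT) $k$-coloring if $V_1,\dots,V_k$ are all nonempty, they partition $V(G)$, and there exist real numbers $\alpha,\beta\in[0,1]$ such that for every vertex $v$ and every $i\in\{1,\dots,k\}$: $e(v,V_i)=\alpha\deg(v)$ if $v\notin V_i$, and $e(v,V_i)=\beta\deg(v)$ if $v\in V_i$. The FAT chromatic number $\chi^{\mathrm{FAT}}(G)$ is the maximum $k$ such that $G$ admits a FAT $k$-coloring (a FAT $1$-coloring always exists). *)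

theory Defs
  imports Complex_Main "HOL-Library.Disjoint_Sets" "Graph_Theory.Graph_Theory"
begin

text \<open>
  A simple graph is a \<^locale>\<open>pair_graph\<close>: finite, loop-free, and with a symmetric set of ordered
  pairs as arcs, so that an edge \<open>uv\<close> is the pair of arcs \<open>(u, v)\<close>, \<open>(v, u)\<close>.
\<close>

definition neighbors :: "'a pair_pre_digraph \<Rightarrow> 'a \<Rightarrow> 'a set" where
  "neighbors G v = {w \<in> pverts G. (v, w) \<in> parcs G}"

definition degree :: "'a pair_pre_digraph \<Rightarrow> 'a \<Rightarrow> nat" where
  "degree G v = card (neighbors G v)"

definition edges_to :: "'a pair_pre_digraph \<Rightarrow> 'a \<Rightarrow> 'a set \<Rightarrow> nat" where
  "edges_to G v S = card (S \<inter> neighbors G v)"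

definition proper_coloring :: "'a pair_pre_digraph \<Rightarrow> nat \<Rightarrow> ('a \<Rightarrow> nat) \<Rightarrow> bool" where
  "proper_coloring G k c \<longleftrightarrow>
     (\<forall>v\<in>pverts G. c v \<in> {1..k}) \<and> (\<forall>(u, v)\<in>parcs G. c u \<noteq> c v)"

definition chromatic_number :: "'a pair_pre_digraph \<Rightarrow> nat" where
  "chromatic_number G = (LEAST k. \<exists>c. proper_coloring G k c)"

definition fat_coloring :: "'a pair_pre_digraph \<Rightarrow> nat \<Rightarrow> (nat \<Rightarrow> 'a set) \<Rightarrow> bool" where
  "fat_coloring G k V \<longleftrightarrow>
     (\<forall>i\<in>{1..k}. V i \<noteq> {}) \<and>
     disjoint_family_on V {1..k} \<and>
     (\<Union>i\<in>{1..k}. V i) = pverts G \<and>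
     (\<exists>\<alpha>\<in>{0..1::real}. \<exists>\<beta>\<in>{0..1::real}. \<forall>v\<in>pverts G. \<forall>i\<in>{1..k}.
        (v \<notin> V i \<longrightarrow> real (edges_to G v (V i)) = \<alpha> * real (degree G v)) \<and>
        (v \<in> V i \<longrightarrow> real (edges_to G v (V i)) = \<beta> * real (degree G v)))"

text \<open>
  The maximum is over a finite nonempty set for graphs with a nonempty vertex set: the classes
  are nonempty and disjoint, so \<open>k \<le> card (pverts G)\<close>, and \<open>k = 1\<close> always occurs.
\<close>

definition fat_chromatic_number :: "'a pair_pre_digraph \<Rightarrow> nat" where
  "fat_chromatic_number G = Max {k. \<exists>V. fat_coloring G k V}"

end

theory Submission
  imports Defs
begin

text \<open>
  Take the disjoint union of one clique of order \<open>L\<^sub>2\<close> and \<open>L\<^sub>1 - 1\<close> cliques of order 2.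
  The components form a FAT \<open>L\<^sub>1\<close>-coloring with \<open>\<alpha> = 0\<close>, \<open>\<beta> = 1\<close>. Conversely, in a FAT
  coloring with \<open>\<alpha> = 0\<close> every class is a union of components, which leaves at most \<open>L\<^sub>1\<close> classes,
  whereas \<open>\<alpha> > 0\<close> forces a vertex to have a neighbor in every class but its own, and a vertex of
  degree 1 allows this for at most \<open>2 \<le> L\<^sub>1\<close> classes.
\<close>

text \<open>A disjoint union of cliques, encoded by a labelling \<open>f\<close> whose nonempty
  fibers in \<open>A\<close> are the components. Adjacency and neighborhoods can then be computed
  from labels.\<close>

definition cluster_graph :: "'a set \<Rightarrow> ('a \<Rightarrow> 'b) \<Rightarrow> 'a pair_pre_digraph" where
  "cluster_graph A f =
     \<lparr>pverts = A, parcs = {(u, v). u \<in> A \<and> v \<in> A \<and> u \<noteq> v \<and> f u = f v}\<rparr>"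

lemma pverts_cluster_graph [simp]: "pverts (cluster_graph A f) = A"
  by (simp add: cluster_graph_def)

lemma parcs_cluster_graph_iff [simp]:
  "(u, v) \<in> parcs (cluster_graph A f) \<longleftrightarrow> u \<in> A \<and> v \<in> A \<and> u \<noteq> v \<and> f u = f v"
  by (simp add: cluster_graph_def)

lemma neighbors_cluster_graph:
  "v \<in> A \<Longrightarrow> neighbors (cluster_graph A f) v = {w \<in> A. w \<noteq> v \<and> f w = f v}"
  by (auto simp: neighbors_def)

lemma pair_graph_cluster_graph:
  assumes "finite A"
  shows "pair_graph (cluster_graph A f)"
proof
  have "parcs (cluster_graph A f) \<subseteq> A \<times> A"
    by auto
  then show "finite (parcs (cluster_graph A f))"
    using assms by (meson finite_SigmaI finite_subset)
  show "symmetric (with_proj (cluster_graph A f))"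
    by (auto simp: symmetric_def intro!: symI)
qed (use assms in \<open>auto\<close>)

lemma cluster_graph_reachable_same_fiber:
  assumes "u \<rightarrow>\<^sup>*\<^bsub>with_proj (cluster_graph A f)\<^esub> v"
  shows "f u = f v"
  using assms unfolding reachable_def by induct auto

lemma cluster_graph_not_connected:
  assumes "finite A" "u \<in> A" "v \<in> A" "f u \<noteq> f v"
  shows "\<not> Digraph_Component.connected (with_proj (cluster_graph A f))"
proof
  interpret pair_graph "cluster_graph A f"
    using assms(1) by (rule pair_graph_cluster_graph)
  assume "Digraph_Component.connected (with_proj (cluster_graph A f))"
  \<comment> \<open>\<open>connected\<close> concerns the underlying undirected graph; since the
    arcs are symmetric, it yields directed reachability between any two vertices.\<close>
  then have "strongly_connected (with_proj (cluster_graph A f))"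
    using symmetric_connected_imp_strongly_connected sym_arcs by blast
  then have "u \<rightarrow>\<^sup>*\<^bsub>with_proj (cluster_graph A f)\<^esub> v"
    using assms(2,3) by (auto simp: strongly_connected_def)
  then show False
    using cluster_graph_reachable_same_fiber assms(4) by metis
qed

text \<open>\<open>c\<close> is injective on every fiber, hence proper, which bounds the chromatic
  number from above. \<open>B\<close> lies in one fiber and is thus a clique, which bounds it from
  below.\<close>

lemma chromatic_number_cluster_graph:
  assumes "\<And>v. v \<in> A \<Longrightarrow> c v \<in> {1..n}"
    and "\<And>u v. u \<in> A \<Longrightarrow> v \<in> A \<Longrightarrow> f u = f v \<Longrightarrow> c u = c v \<Longrightarrow> u = v"
    and "B \<subseteq> A" "card B = n" "\<And>u v. u \<in> B \<Longrightarrow> v \<in> B \<Longrightarrow> f u = f v"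
  shows "chromatic_number (cluster_graph A f) = n"
  unfolding chromatic_number_def
proof (rule Least_equality)
  show "\<exists>c. proper_coloring (cluster_graph A f) n c"
    using assms(1,2) unfolding proper_coloring_def by (intro exI[of _ c]) auto
next
  fix k assume "\<exists>c. proper_coloring (cluster_graph A f) k c"
  then obtain d where d: "proper_coloring (cluster_graph A f) k d"
    by blast
  have d_neq: "d u \<noteq> d v" if "(u, v) \<in> parcs (cluster_graph A f)" for u v
    using d that unfolding proper_coloring_def by blast
  have "inj_on d B"
    using d_neq assms(3,5) by (intro inj_onI) (metis parcs_cluster_graph_iff subsetD)
  moreover have "d ` B \<subseteq> {1..k}"
    using d assms(3) by (auto simp: proper_coloring_def)
  ultimately have "card B \<le> card {1..k}"
    by (intro card_inj_on_le) auto
  then show "n \<le> k"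
    using assms(4) by simp
qed

lemma fat_coloring_cluster_graph_fibers:
  assumes "f ` A = {1..k}"
  shows "fat_coloring (cluster_graph A f) k (\<lambda>i. {v \<in> A. f v = i})"
  unfolding fat_coloring_def
proof (intro conjI)
  show "\<forall>i\<in>{1..k}. {v \<in> A. f v = i} \<noteq> {}"
  proof
    fix i assume "i \<in> {1..k}"
    then have "i \<in> f ` A"
      using assms by simp
    then show "{v \<in> A. f v = i} \<noteq> {}"
      by blast
  qed
  show "disjoint_family_on (\<lambda>i. {v \<in> A. f v = i}) {1..k}"
    by (auto simp: disjoint_family_on_def)
  show "(\<Union>i\<in>{1..k}. {v \<in> A. f v = i}) = pverts (cluster_graph A f)"
    using assms by auto
  have own: "edges_to (cluster_graph A f) v {w \<in> A. f w = f v} = degree (cluster_graph A f) v"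
    if "v \<in> A" for v
    unfolding edges_to_def degree_def
    using that by (intro arg_cong[of _ _ card]) (auto simp: neighbors_cluster_graph)
  have other: "edges_to (cluster_graph A f) v {w \<in> A. f w = i} = 0"
    if "v \<in> A" "f v \<noteq> i" for v i
  proof -
    have "{w \<in> A. f w = i} \<inter> neighbors (cluster_graph A f) v = {}"
      using that by (auto simp: neighbors_cluster_graph)
    then show ?thesis
      by (simp add: edges_to_def)
  qed
  show "\<exists>\<alpha>\<in>{0..1::real}. \<exists>\<beta>\<in>{0..1::real}. \<forall>v\<in>pverts (cluster_graph A f). \<forall>i\<in>{1..k}.
      (v \<notin> {v \<in> A. f v = i} \<longrightarrow>
        real (edges_to (cluster_graph A f) v {v \<in> A. f v = i})
          = \<alpha> * real (degree (cluster_graph A f) v)) \<and>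
      (v \<in> {v \<in> A. f v = i} \<longrightarrow>
        real (edges_to (cluster_graph A f) v {v \<in> A. f v = i})
          = \<beta> * real (degree (cluster_graph A f) v))"
    by (intro bexI[of _ 0] bexI[of _ 1]) (auto simp: own other)
qed

text \<open>Only through \<open>w\<close> can \<open>v\<close> meet a class, so \<open>w\<close>
  lies in every class that misses \<open>v\<close>.\<close>

lemma fat_coloring_le_2_if_leaf:
  fixes k :: nat
  assumes disj: "disjoint_family_on V {1..k}"
    and leaf: "neighbors G v = {w}"
    and meets: "\<And>i. i \<in> {1..k} \<Longrightarrow> v \<notin> V i \<Longrightarrow> edges_to G v (V i) > 0"
  shows "k \<le> 2"
proof -
  have eq: "i = j" if "i \<in> {1..k}" "j \<in> {1..k}" "x \<in> V i" "x \<in> V j" for i j x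
    using disj that unfolding disjoint_family_on_def by blast
  have w: "w \<in> V i" if "i \<in> {1..k}" "v \<notin> V i" for i
    using meets[OF that] leaf by (auto simp: edges_to_def card_gt_0_iff)
  show ?thesis
  proof (rule ccontr)
    assume "\<not> k \<le> 2"
    then have k: "1 \<in> {1..k}" "2 \<in> {1..k}" "3 \<in> {1..k}"
      by auto
    \<comment> \<open>By disjointness \<open>v\<close> and \<open>w\<close> each lie in at most one
      of three classes, so some class contains neither.\<close>
    have "\<not> (v \<in> V 1 \<and> v \<in> V 2)" "\<not> (v \<in> V 1 \<and> v \<in> V 3)" "\<not> (v \<in> V 2 \<and> v \<in> V 3)"
      "\<not> (w \<in> V 1 \<and> w \<in> V 2)" "\<not> (w \<in> V 1 \<and> w \<in> V 3)" "\<not> (w \<in> V 2 \<and> w \<in> V 3)"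
      using eq[OF k(1) k(2)] eq[OF k(1) k(3)] eq[OF k(2) k(3)] by fastforce+
    then show False
      using w[OF k(1)] w[OF k(2)] w[OF k(3)] by blast
  qed
qed

text \<open>The two arguments of \<open>max\<close> come from two cases: the leaf gives 2 when
  \<alpha> > 0, and the number of cliques is the bound when \<alpha> = 0.\<close>

lemma fat_coloring_cluster_graph_le:
  assumes fin: "finite A"
    and fat: "fat_coloring (cluster_graph A f) k V"
    and leaf: "v \<in> A" "neighbors (cluster_graph A f) v = {w}"
  shows "k \<le> max 2 (card (f ` A))"
proof -
  let ?G = "cluster_graph A f"
  from fat obtain \<alpha> :: real where ne: "\<And>i. i \<in> {1..k} \<Longrightarrow> V i \<noteq> {}"
    and disj: "disjoint_family_on V {1..k}"
    and un: "(\<Union>i\<in>{1..k}. V i) = A"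
    and \<alpha>: "\<alpha> \<ge> 0"
    and out: "\<And>u i. u \<in> A \<Longrightarrow> i \<in> {1..k} \<Longrightarrow> u \<notin> V i \<Longrightarrow>
      real (edges_to ?G u (V i)) = \<alpha> * real (degree ?G u)"
    unfolding fat_coloring_def by auto
  show ?thesis
  proof (cases "\<alpha> = 0")
    case False
    \<comment> \<open>With degree 1, the number of neighbors of \<open>v\<close> in a foreign class
      is \<alpha> itself.\<close>
    have "degree ?G v = 1"
      using leaf by (simp add: degree_def)
    then have "edges_to ?G v (V i) > 0" if "i \<in> {1..k}" "v \<notin> V i" for i
      using out[OF leaf(1) that] \<alpha> False by simp
    then have "k \<le> 2"
      using fat_coloring_le_2_if_leaf disj leaf(2) by metis
    then show ?thesis
      by simp
  next
    case True
    define r where "r i = (SOME x. x \<in> V i)" for i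
    have r: "r i \<in> V i" if "i \<in> {1..k}" for i
      using ne[OF that] by (simp add: r_def some_in_eq)
    have rA: "r i \<in> A" if "i \<in> {1..k}" for i
      using r[OF that] that un by blast
    \<comment> \<open>Each class is sent to the clique of its representative. If two classes shared
      a clique, their representatives would be adjacent, an edge between classes that \<alpha> = 0
      forbids.\<close>
    have "inj_on (f \<circ> r) {1..k}"
    proof (rule inj_onI, rule ccontr)
      fix i j assume ij: "i \<in> {1..k}" "j \<in> {1..k}" "(f \<circ> r) i = (f \<circ> r) j" "i \<noteq> j"
      then have *: "V i \<inter> V j = {}"
        using disj unfolding disjoint_family_on_def by blast
      with r ij have notin: "r i \<notin> V j"
        by blast
      then have "r j \<in> V j \<inter> neighbors ?G (r i)"
        using r[OF ij(2)] rA ij by (auto simp: neighbors_cluster_graph)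
      moreover have "finite (V j \<inter> neighbors ?G (r i))"
        using fin by (auto simp: neighbors_def)
      ultimately have "edges_to ?G (r i) (V j) > 0"
        unfolding edges_to_def card_gt_0_iff by blast
      then show False
        using out[OF rA[OF ij(1)] ij(2) notin] True by simp
    qed
    moreover have "(f \<circ> r) ` {1..k} \<subseteq> f ` A"
      using rA by auto
    ultimately have "card {1..k} \<le> card (f ` A)"
      using fin by (intro card_inj_on_le[of "f \<circ> r"]) simp_all
    then show ?thesis
      by simp
  qed
qed

text \<open>The fibers attain \<open>k\<close>, and \<open>2 \<le> k\<close> absorbs the 2 in the
  upper bound. That bound also makes the set under \<open>Max\<close> finite.\<close>

lemma fat_chromatic_number_cluster_graph:
  assumes "finite A" "f ` A = {1..k}" "2 \<le> k" "v \<in> A"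
    "neighbors (cluster_graph A f) v = {w}"
  shows "fat_chromatic_number (cluster_graph A f) = k"
  unfolding fat_chromatic_number_def
proof (rule Max_eqI)
  have le: "l \<le> k" if "fat_coloring (cluster_graph A f) l V" for l V
    using fat_coloring_cluster_graph_le[OF assms(1) that assms(4,5)] assms(2,3) by simp
  have "{l. \<exists>V. fat_coloring (cluster_graph A f) l V} \<subseteq> {..k}"
    using le by blast
  then show "finite {l. \<exists>V. fat_coloring (cluster_graph A f) l V}"
    by (rule finite_subset) simp
  show "l \<le> k" if "l \<in> {l. \<exists>V. fat_coloring (cluster_graph A f) l V}" for l
    using that le by blast
  show "k \<in> {l. \<exists>V. fat_coloring (cluster_graph A f) l V}"
    using fat_coloring_cluster_graph_fibers[OF assms(2)] by blast
qed

theorem theorem2p2: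
  fixes L1 L2 :: nat
  assumes "1 < L1" and "L1 < L2"
  shows "\<exists>G :: nat pair_pre_digraph.
           pair_graph G \<and> pverts G \<noteq> {} \<and> \<not> Digraph_Component.connected (with_proj G) \<and>
           fat_chromatic_number G = L1 \<and> chromatic_number G = L2"
proof -
  \<comment> \<open>The vertices below \<open>L2\<close> form the large clique, labelled 1; the
    others are paired consecutively, and the pairs carry the labels from 2 to
    \<open>L1\<close>.\<close>
  define A where "A = {..<L2 + 2 * (L1 - 1)}"
  define f where "f v = (if v < L2 then 1 else 2 + (v - L2) div 2)" for v
  \<comment> \<open>The large clique uses each color from 1 to \<open>L2\<close> once; every pair
    reuses colors 1 and 2.\<close>
  define c where "c v = (if v < L2 then Suc v else Suc ((v - L2) mod 2))" for v
  let ?G = "cluster_graph A f"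
  have fin: "finite A"
    by (simp add: A_def)
  have mem: "0 \<in> A" "L2 \<in> A"
    using assms by (auto simp: A_def)
  have "\<not> Digraph_Component.connected (with_proj ?G)"
    using fin mem by (rule cluster_graph_not_connected) (use assms in \<open>auto simp: f_def\<close>)
  moreover have "fat_chromatic_number ?G = L1"
  proof (rule fat_chromatic_number_cluster_graph[OF fin _ _ mem(2)])
    show "f ` A = {1..L1}"
    proof
      show "f ` A \<subseteq> {1..L1}"
        using assms by (auto simp: A_def f_def)
      show "{1..L1} \<subseteq> f ` A"
      proof
        fix i assume i: "i \<in> {1..L1}"
        show "i \<in> f ` A"
        proof (cases "i = 1")
          case True
          then show ?thesis
            using mem(1) assms by (intro image_eqI[of _ _ 0]) (auto simp: f_def)
        next
          case False
          then show ?thesis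
            \<comment> \<open>The witness is the first vertex of the pair labelled
              \<open>i\<close>.\<close>
            using i assms by (intro image_eqI[of _ _ "L2 + 2 * (i - 2)"]) (auto simp: f_def A_def)
        qed
      qed
    qed
    \<comment> \<open>The required leaf: \<open>L2\<close> begins the first pair, which exists
      because \<open>1 < L1\<close>.\<close>
    show "neighbors ?G L2 = {Suc L2}"
      using assms mem by (auto simp: neighbors_cluster_graph f_def A_def)
  qed (use assms in simp)
  moreover have "chromatic_number ?G = L2"
  proof (rule chromatic_number_cluster_graph)
    show "c v \<in> {1..L2}" if "v \<in> A" for v
      using assms by (auto simp: c_def)
    show "u = v" if "u \<in> A" "v \<in> A" "f u = f v" "c u = c v" for u v
    proof (cases "u < L2 \<or> v < L2")
      case True
      then show ?thesis
        using that by (auto simp: f_def c_def split: if_splits)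
    next
      case False
      \<comment> \<open>Outside the large clique, \<open>f\<close> records the quotient and
        \<open>c\<close> the remainder of the offset modulo 2; together they determine the
        vertex.\<close>
      then have "(u - L2) div 2 = (v - L2) div 2" "(u - L2) mod 2 = (v - L2) mod 2"
        using that by (simp_all add: f_def c_def)
      then have "u - L2 = v - L2"
        by (metis div_mult_mod_eq)
      then show ?thesis
        using False by linarith
    qed
    show "{..<L2} \<subseteq> A" "card {..<L2} = L2"
      by (auto simp: A_def)
    show "f u = f v" if "u \<in> {..<L2}" "v \<in> {..<L2}" for u v
      using that by (simp add: f_def)
  qed
  ultimately show ?thesis
    using pair_graph_cluster_graph[OF fin, of f] mem by (intro exI[of _ ?G]) auto
qed

end
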